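(* Let $\mathfrak{M}=(V,\langle\cdot,\cdot\rangle,A)$, where $V$ is a finite-dimensional real vector space, $\langle\cdot,\cdot\rangle$ is a non-degenerate symmetric bilinear form of signature $(p,q)$ on $V$, and $A$ is an algebraic curvature tensor on $V$. Suppose that $\mathfrak{M}$ is Jacobi--Tsankov. Then: (1) $\mathcal{J}(x)^2=0$ for all $x\in V$. (2) $\mathfrak{M}$ is Osserman. (3) If $V$ is Riemannian ($p=0$) or Lorentzian ($p=1$), then $A=0$.
   Context: An algebraic curvature tensor on $V$ is $A\in\otimes^4V^*$ with $A(x,y,z,w)=-A(y,x,z,w)=A(z,w,x,y)$ and $A(x,y,z,w)+A(y,z,x,w)+A(z,x,y,w)=0$ for all $x,y,z,w\in V$. Signature $(p,q)$ means $p$ timelike (negative) and $q$ spacelike (positive) directions, so $\dim V=p+q$. The curvature operator $\mathcal{A}(x,y)\in\operatorname{End}(V)$ is defined by $\langle\mathcal{A}(x,y)z,w\rangle=A(x,y,z,w)$, and the Jacobi operator is $\mathcal{J}(x):y\mapsto\mathcal{A}(y,x)x$. $\mathfrak{M}$ is Jacobi--Tsankov if $\mathcal{J}(x)\mathcal{J}(y)=\mathcal{J}(y)\mathcal{J}(x)$ for all $x,y\in V$. $\mathfrak{M}$ is Osserman if the (complex) eigenvalues of $\mathcal{J}(x)$ are constant on the set of unit spacelike vectors $\{x:\langle x,x\rangle=1\}$ and constant on the set of unit timelike vectors $\{x:\langle x,x\rangle=-1\}$. *)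

theory Defs
  imports "HOL-Analysis.Analysis"
begin

text \<open>The space V is the whole of a type of class \<open>real_vector\<close>; this class carries no norm, inner
  product or topology. Finite dimension is the explicit predicate below.\<close>

definition finite_dim :: "'v::real_vector itself \<Rightarrow> bool" where
  "finite_dim _ \<longleftrightarrow> (\<exists>B::'v set. finite B \<and> span B = UNIV)"

definition nondegenerate :: "('v::real_vector \<Rightarrow> 'v \<Rightarrow> real) \<Rightarrow> bool" where
  "nondegenerate g \<longleftrightarrow> (\<forall>x. (\<forall>y. g x y = 0) \<longrightarrow> x = 0)"

text \<open>Signature (p,q): some orthonormal basis \<open>N \<union> P\<close> consists of p timelike vectors (the set N)
  and q spacelike ones (the set P). The numbers do not depend on the basis, by Sylvester's law.\<close>

definition has_signature :: "('v::real_vector \<Rightarrow> 'v \<Rightarrow> real) \<Rightarrow> nat \<Rightarrow> nat \<Rightarrow> bool" where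
  "has_signature g p q \<longleftrightarrow>
    (\<exists>N P. finite N \<and> finite P \<and> card N = p \<and> card P = q \<and> N \<inter> P = {} \<and>
       independent (N \<union> P) \<and> span (N \<union> P) = UNIV \<and>
       (\<forall>b\<in>N. g b b = -1) \<and> (\<forall>b\<in>P. g b b = 1) \<and>
       (\<forall>b\<in>N \<union> P. \<forall>c\<in>N \<union> P. b \<noteq> c \<longrightarrow> g b c = 0))"

definition algebraic_curvature_tensor ::
    "('v::real_vector \<Rightarrow> 'v \<Rightarrow> 'v \<Rightarrow> 'v \<Rightarrow> real) \<Rightarrow> bool" where
  "algebraic_curvature_tensor A \<longleftrightarrow>
    (\<forall>y z w. linear (\<lambda>x. A x y z w)) \<and> (\<forall>x z w. linear (\<lambda>y. A x y z w)) \<and>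
    (\<forall>x y w. linear (\<lambda>z. A x y z w)) \<and> (\<forall>x y z. linear (\<lambda>w. A x y z w)) \<and>
    (\<forall>x y z w. A x y z w = - A y x z w) \<and>
    (\<forall>x y z w. A x y z w = A z w x y) \<and>
    (\<forall>x y z w. A x y z w + A y z x w + A z x y w = 0)"

text \<open>The description is well defined when V is finite-dimensional, g is bilinear and nondegenerate,
  and A is linear in its last argument.\<close>

definition curvature_operator ::
    "('v::real_vector \<Rightarrow> 'v \<Rightarrow> real) \<Rightarrow> ('v \<Rightarrow> 'v \<Rightarrow> 'v \<Rightarrow> 'v \<Rightarrow> real) \<Rightarrow> 'v \<Rightarrow> 'v \<Rightarrow> 'v \<Rightarrow> 'v" where
  "curvature_operator g A x y z = (THE u. \<forall>w. g u w = A x y z w)"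

definition jacobi_operator ::
    "('v::real_vector \<Rightarrow> 'v \<Rightarrow> real) \<Rightarrow> ('v \<Rightarrow> 'v \<Rightarrow> 'v \<Rightarrow> 'v \<Rightarrow> real) \<Rightarrow> 'v \<Rightarrow> 'v \<Rightarrow> 'v" where
  "jacobi_operator g A x = (\<lambda>y. curvature_operator g A y x x)"

definition jacobi_tsankov ::
    "('v::real_vector \<Rightarrow> 'v \<Rightarrow> real) \<Rightarrow> ('v \<Rightarrow> 'v \<Rightarrow> 'v \<Rightarrow> 'v \<Rightarrow> real) \<Rightarrow> bool" where
  "jacobi_tsankov g A \<longleftrightarrow>
    (\<forall>x y. jacobi_operator g A x \<circ> jacobi_operator g A y =
           jacobi_operator g A y \<circ> jacobi_operator g A x)"

text \<open>The complexification of V is modelled as \<open>V \<times> V\<close>, where \<open>(u, v)\<close> stands for \<open>u + \<i>v\<close>.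
  A real operator T extends to it as \<open>map_prod T T\<close>.\<close>

definition complexified_scale :: "complex \<Rightarrow> 'v::real_vector \<times> 'v \<Rightarrow> 'v \<times> 'v" where
  "complexified_scale c = (\<lambda>(u, v). (Re c *\<^sub>R u - Im c *\<^sub>R v, Im c *\<^sub>R u + Re c *\<^sub>R v))"

definition complex_eigenvalues :: "('v::real_vector \<Rightarrow> 'v) \<Rightarrow> complex set" where
  "complex_eigenvalues T = {c. \<exists>w. w \<noteq> 0 \<and> map_prod T T w = complexified_scale c w}"

text \<open>Constancy refers to the set of eigenvalues. In finite dimension, this already forces the
  algebraic multiplicities to be constant: the coefficients of the characteristic polynomial of
  the Jacobi operator of x depend continuously on x, each of the two sets of unit vectors is
  connected or has the two components exchanged by \<open>x \<mapsto> -x\<close>, and the Jacobi operators of x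
  and of -x are equal.\<close>

definition osserman ::
    "('v::real_vector \<Rightarrow> 'v \<Rightarrow> real) \<Rightarrow> ('v \<Rightarrow> 'v \<Rightarrow> 'v \<Rightarrow> 'v \<Rightarrow> real) \<Rightarrow> bool" where
  "osserman g A \<longleftrightarrow>
    (\<forall>x y. g x x = 1 \<and> g y y = 1 \<longrightarrow>
       complex_eigenvalues (jacobi_operator g A x) = complex_eigenvalues (jacobi_operator g A y)) \<and>
    (\<forall>x y. g x x = -1 \<and> g y y = -1 \<longrightarrow>
       complex_eigenvalues (jacobi_operator g A x) = complex_eigenvalues (jacobi_operator g A y))"

end

theory Submission
  imports Defs
begin

text \<open>Polarising \<open>J(x)x = 0\<close> gives \<open>J(x)y = J(y)x - J(x+y)x\<close>. Applying \<open>J(x)\<close> and commuting it past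
  \<open>J(y)\<close> and \<open>J(x+y)\<close> yields \<open>J(x)\<^sup>2 = 0\<close>, so 0 is the only eigenvalue of a Jacobi operator. As
  \<open>J(x)\<close> is self-adjoint, every \<open>J(x)y\<close> is then a null vector orthogonal to x. In the definite case it
  vanishes; in the Lorentzian case it vanishes for timelike x, and since every vector is a difference of
  timelike ones, polarisation gives \<open>J = 0\<close>. The Bianchi identity turns \<open>J = 0\<close> into \<open>A = 0\<close>.\<close>

section \<open>Complex eigenvalues of square-zero operators\<close>

text \<open>An eigenvector w for c satisfies c*c*w = 0, which forces c = 0; the vector
  \<open>x\<close> in the kernel shows that 0 does occur. The computation runs in real and imaginary
  parts because the complexification is a set of pairs.\<close>

lemma complex_eigenvalues_square_zero:
  fixes T :: "'v::real_vector \<Rightarrow> 'v"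
  assumes "linear T" and sq: "\<And>y. T (T y) = 0" and "x \<noteq> 0" and "T x = 0"
  shows "complex_eigenvalues T = {0}"
proof (intro equalityI subsetI)
  fix c assume "c \<in> {0::complex}"
  then have "map_prod T T (x, 0) = complexified_scale c (x, 0)"
    using assms by (simp add: complexified_scale_def linear_0)
  with \<open>x \<noteq> 0\<close> show "c \<in> complex_eigenvalues T"
    unfolding complex_eigenvalues_def by (auto simp: zero_prod_def)
next
  fix c assume "c \<in> complex_eigenvalues T"
  then obtain u v where uv: "(u, v) \<noteq> 0"
    and eq: "map_prod T T (u, v) = complexified_scale c (u, v)"
    unfolding complex_eigenvalues_def by auto
  define a b where "a = Re c" and "b = Im c"
  have Tu: "T u = a *\<^sub>R u - b *\<^sub>R v" and Tv: "T v = b *\<^sub>R u + a *\<^sub>R v"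
    using eq by (auto simp: complexified_scale_def a_def b_def)
  have "0 = T (a *\<^sub>R u - b *\<^sub>R v)" using sq[of u] Tu by simp
  also have "\<dots> = a *\<^sub>R T u - b *\<^sub>R T v"
    using \<open>linear T\<close> by (simp add: linear_diff linear_scale)
  also have "\<dots> = (a\<^sup>2 - b\<^sup>2) *\<^sub>R u - (2 * a * b) *\<^sub>R v"
    unfolding Tu Tv by (simp add: algebra_simps power2_eq_square flip: scaleR_add_left)
  finally have 1: "(a\<^sup>2 - b\<^sup>2) *\<^sub>R u - (2 * a * b) *\<^sub>R v = 0" by simp
  have "0 = T (b *\<^sub>R u + a *\<^sub>R v)" using sq[of v] Tv by simp
  also have "\<dots> = b *\<^sub>R T u + a *\<^sub>R T v"
    using \<open>linear T\<close> by (simp add: linear_add linear_scale)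
  also have "\<dots> = (2 * a * b) *\<^sub>R u + (a\<^sup>2 - b\<^sup>2) *\<^sub>R v"
    unfolding Tu Tv by (simp add: algebra_simps power2_eq_square flip: scaleR_add_left)
  finally have 2: "(2 * a * b) *\<^sub>R u + (a\<^sup>2 - b\<^sup>2) *\<^sub>R v = 0" by simp
  \<comment> \<open>Equations \<open>1\<close> and \<open>2\<close> are the real and imaginary parts
    of c*c*w = 0. Multiplying by the conjugate of c*c separates \<open>u\<close> from
    \<open>v\<close>, each with the factor |c|^4 computed here.\<close>
  have norm4: "(a\<^sup>2 - b\<^sup>2) * (a\<^sup>2 - b\<^sup>2) + (2*a*b) * (2*a*b) = (a\<^sup>2 + b\<^sup>2)\<^sup>2"
    by (simp add: algebra_simps power2_eq_square)
  have "(a\<^sup>2 - b\<^sup>2) *\<^sub>R ((a\<^sup>2 - b\<^sup>2) *\<^sub>R u - (2*a*b) *\<^sub>R v)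
      + (2*a*b) *\<^sub>R ((2*a*b) *\<^sub>R u + (a\<^sup>2 - b\<^sup>2) *\<^sub>R v) = (a\<^sup>2 + b\<^sup>2)\<^sup>2 *\<^sub>R u"
    unfolding norm4[symmetric]
    by (simp only: scaleR_add_right scaleR_diff_right scaleR_add_left scaleR_scaleR) (simp add: mult.commute)
  then have u: "(a\<^sup>2 + b\<^sup>2)\<^sup>2 *\<^sub>R u = 0" using 1 2 by simp
  have "(a\<^sup>2 - b\<^sup>2) *\<^sub>R ((2*a*b) *\<^sub>R u + (a\<^sup>2 - b\<^sup>2) *\<^sub>R v)
      - (2*a*b) *\<^sub>R ((a\<^sup>2 - b\<^sup>2) *\<^sub>R u - (2*a*b) *\<^sub>R v) = (a\<^sup>2 + b\<^sup>2)\<^sup>2 *\<^sub>R v"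
    unfolding norm4[symmetric]
    by (simp only: scaleR_add_right scaleR_diff_right scaleR_add_left scaleR_scaleR) (simp add: mult.commute)
  then have v: "(a\<^sup>2 + b\<^sup>2)\<^sup>2 *\<^sub>R v = 0" using 1 2 by simp
  from u v uv have "a = 0 \<and> b = 0" by (auto simp: zero_prod_def sum_power2_eq_zero_iff)
  then show "c \<in> {0}" by (simp add: a_def b_def complex_eq_iff)
qed

section \<open>Orthonormal bases and null vectors\<close>

text \<open>In coordinates with respect to \<open>P\<close>, the value \<open>g x x\<close> is the
  sum of the squares of the coefficients.\<close>

lemma positive_definite_on_orthonormal_span:
  fixes g :: "'v::real_vector \<Rightarrow> 'v \<Rightarrow> real"
  assumes "bilinear g" and "finite P" and unit: "\<And>b. b \<in> P \<Longrightarrow> g b b = 1"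
    and orth: "\<And>b c. b \<in> P \<Longrightarrow> c \<in> P \<Longrightarrow> b \<noteq> c \<Longrightarrow> g b c = 0"
    and "x \<in> span P"
  shows "0 \<le> g x x" and "g x x = 0 \<Longrightarrow> x = 0"
proof -
  obtain f where x: "x = (\<Sum>b\<in>P. f b *\<^sub>R b)"
    using \<open>x \<in> span P\<close> span_finite[OF \<open>finite P\<close>] by auto
  have "g x x = (\<Sum>(b, c)\<in>P \<times> P. f b * (f c * g b c))"
    using \<open>bilinear g\<close> unfolding x
    by (simp add: bilinear_sum bilinear_lmul bilinear_rmul split_def)
  also have "\<dots> = (\<Sum>b\<in>P. \<Sum>c\<in>P. f b * (f c * g b c))"
    by (simp add: sum.cartesian_product)
  also have "\<dots> = (\<Sum>b\<in>P. \<Sum>c\<in>P. if c = b then (f b)\<^sup>2 else 0)"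
    using unit orth by (intro sum.cong refl) (auto simp: power2_eq_square)
  also have "\<dots> = (\<Sum>b\<in>P. (f b)\<^sup>2)" using \<open>finite P\<close> by simp
  finally have gx: "g x x = (\<Sum>b\<in>P. (f b)\<^sup>2)" .
  show "0 \<le> g x x" unfolding gx by (simp add: sum_nonneg)
  show "x = 0" if "g x x = 0"
  proof -
    have "\<forall>b\<in>P. (f b)\<^sup>2 = 0"
      using that \<open>finite P\<close> unfolding gx by (subst (asm) sum_nonneg_eq_0_iff) auto
    then show ?thesis unfolding x by simp
  qed
qed

text \<open>This supplies the vector that the definite description in
  \<open>curvature_operator\<close> refers to.\<close>

lemma has_signature_riesz:
  fixes g :: "'v::real_vector \<Rightarrow> 'v \<Rightarrow> real"
  assumes "bilinear g" and "has_signature g p q" and "linear f"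
  shows "\<exists>u. \<forall>w. g u w = f w"
proof -
  from \<open>has_signature g p q\<close> obtain N P where fin: "finite (N \<union> P)" and span: "span (N \<union> P) = UNIV"
    and N: "\<forall>b\<in>N. g b b = -1" and P: "\<forall>b\<in>P. g b b = 1"
    and orth: "\<forall>b\<in>N \<union> P. \<forall>c\<in>N \<union> P. b \<noteq> c \<longrightarrow> g b c = 0"
    unfolding has_signature_def by auto
  \<comment> \<open>The factor \<open>g b b\<close> is 1 or -1 and squares to 1, so it corrects the
    sign at timelike basis vectors.\<close>
  define u where "u = (\<Sum>b\<in>N \<union> P. (g b b * f b) *\<^sub>R b)"
  have lin: "linear (g u)" using \<open>bilinear g\<close> by (simp add: bilinear_def)
  have "g u c = f c" if c: "c \<in> N \<union> P" for c
  proof -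
    have "linear (\<lambda>x. g x c)" using \<open>bilinear g\<close> by (simp add: bilinear_def)
    note lin_c = linear_sum[OF this] linear_scale[OF this]
    have "g u c = (\<Sum>b\<in>N \<union> P. (g b b * f b) * g b c)"
      unfolding u_def by (simp add: lin_c)
    also have "\<dots> = (\<Sum>b\<in>N \<union> P. if b = c then f c else 0)"
      using c orth N P by (intro sum.cong refl) auto
    also have "\<dots> = f c" using fin c by simp
    finally show ?thesis .
  qed
  then have "g u w = f w" for w
    using linear_eq_on_span[OF lin \<open>linear f\<close>, of "N \<union> P" w] span by auto
  then show ?thesis by blast
qed

lemma riemannian_null_vector:
  fixes g :: "'v::real_vector \<Rightarrow> 'v \<Rightarrow> real"
  assumes "bilinear g" and "has_signature g 0 q" and "g v v = 0"
  shows "v = 0"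
proof -
  from \<open>has_signature g 0 q\<close> obtain P where P: "finite P" "span P = UNIV" "\<forall>b\<in>P. g b b = 1"
    "\<forall>b\<in>P. \<forall>c\<in>P. b \<noteq> c \<longrightarrow> g b c = 0"
    unfolding has_signature_def by (auto simp: card_eq_0_iff)
  then show ?thesis
    using positive_definite_on_orthonormal_span(2)[OF \<open>bilinear g\<close>, of P v] \<open>g v v = 0\<close> by auto
qed

text \<open>Take \<open>e\<close> to be the only timelike vector of the orthonormal basis: its
  orthogonal complement is the span of the spacelike ones, where \<open>g\<close> is positive
  definite.\<close>

lemma lorentzian_timelike_complement:
  fixes g :: "'v::real_vector \<Rightarrow> 'v \<Rightarrow> real"
  assumes "bilinear g" and "has_signature g 1 q"
  obtains e where "g e e = -1"
    and "\<And>x. g e x = 0 \<Longrightarrow> 0 \<le> g x x" and "\<And>x. g e x = 0 \<Longrightarrow> g x x = 0 \<Longrightarrow> x = 0"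
proof -
  from \<open>has_signature g 1 q\<close> obtain N P where "card N = 1" and P: "finite P" "\<forall>b\<in>P. g b b = 1"
    and NP: "N \<inter> P = {}" "span (N \<union> P) = UNIV" "\<forall>b\<in>N. g b b = -1"
    and orth: "\<forall>b\<in>N \<union> P. \<forall>c\<in>N \<union> P. b \<noteq> c \<longrightarrow> g b c = 0"
    unfolding has_signature_def by auto
  obtain e where N: "N = {e}" using \<open>card N = 1\<close> by (rule card_1_singletonE)
  then have e: "g e e = -1" and span: "span (insert e P) = UNIV" using NP by auto
  have eP: "g e b = 0" if "b \<in> P" for b using that orth NP(1) N by auto
  have lin: "linear (g e)" using \<open>bilinear g\<close> by (simp add: bilinear_def)
  have in_span: "x \<in> span P" if "g e x = 0" for x
  proof -
    have "x \<in> span (insert e P)" using span by simp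
    then obtain k where k: "x - k *\<^sub>R e \<in> span P" unfolding span_breakdown_eq by blast
    have "g e (x - k *\<^sub>R e) = 0"
      by (rule linear_eq_0_on_span[OF lin eP k])
    then have "k = 0" using that e lin by (simp add: linear_diff linear_scale)
    then show ?thesis using k by simp
  qed
  have P_orth: "g b b = 1" "b \<noteq> c \<Longrightarrow> g b c = 0" if "b \<in> P" "c \<in> P" for b c
    using that P(2) orth by auto
  note definite = positive_definite_on_orthonormal_span[OF \<open>bilinear g\<close> P(1) P_orth in_span]
  show ?thesis by (rule that[OF e]) (rule definite; assumption)+
qed

lemma lorentzian_null_orthogonal_to_timelike:
  fixes g :: "'v::real_vector \<Rightarrow> 'v \<Rightarrow> real"
  assumes g: "bilinear g" and sym: "\<And>x y. g x y = g y x" and sig: "has_signature g 1 q"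
    and t: "g t t < 0" and tv: "g t v = 0" and v: "g v v = 0"
  shows "v = 0"
proof -
  obtain e where e: "g e e = -1" and nonneg: "\<And>x. g e x = 0 \<Longrightarrow> 0 \<le> g x x"
    and definite: "\<And>x. g e x = 0 \<Longrightarrow> g x x = 0 \<Longrightarrow> x = 0"
    using lorentzian_timelike_complement[OF g sig] by metis
  \<comment> \<open>This combination of \<open>t\<close> and \<open>v\<close> is orthogonal to
    \<open>e\<close>, so \<open>g w w\<close> is nonnegative. As \<open>v\<close> is null and
    orthogonal to \<open>t\<close>, only the \<open>t\<close> term of \<open>g w w\<close> survives,
    and it is negative unless \<open>g e v = 0\<close>.\<close>
  define w where "w = g e v *\<^sub>R t - g e t *\<^sub>R v"
  note expand = bilinear_lsub[OF g] bilinear_rsub[OF g] bilinear_lmul[OF g] bilinear_rmul[OF g]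
  have "g e w = 0" unfolding w_def by (simp add: expand)
  then have "0 \<le> g w w" by (rule nonneg)
  also have "g w w = (g e v)\<^sup>2 * g t t"
    using tv v sym[of v t] unfolding w_def by (simp add: expand power2_eq_square)
  finally have "g e v = 0" using t by (simp add: zero_le_mult_iff)
  then show ?thesis using definite v by blast
qed

section \<open>Jacobi operators of an algebraic curvature tensor\<close>

locale curvature_model =
  fixes g :: "'v::real_vector \<Rightarrow> 'v \<Rightarrow> real"
    and A :: "'v \<Rightarrow> 'v \<Rightarrow> 'v \<Rightarrow> 'v \<Rightarrow> real"
    and p q :: nat
  assumes bilinear: "bilinear g"
    and sym: "g x y = g y x"
    and nondegenerate: "nondegenerate g"
    and signature: "has_signature g p q"
    and curvature: "algebraic_curvature_tensor A"
begin

abbreviation J :: "'v \<Rightarrow> 'v \<Rightarrow> 'v" where "J \<equiv> jacobi_operator g A"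

lemma A_linear:
  "linear (\<lambda>x. A x y z w)" "linear (\<lambda>y. A x y z w)" "linear (\<lambda>z. A x y z w)" "linear (A x y z)"
  and A_antisym: "A x y z w = - A y x z w"
  and A_pair: "A x y z w = A z w x y"
  and A_bianchi: "A x y z w + A y z x w + A z x y w = 0"
  using curvature unfolding algebraic_curvature_tensor_def by - (elim conjE, (erule allE)+, assumption)+

lemmas A_add = A_linear[THEN linear_add]
lemmas A_diff = A_linear[THEN linear_diff]
lemmas A_scale = A_linear[THEN linear_scale]

lemma g_eqI:
  assumes "\<And>w. g u w = g v w"
  shows "u = v"
proof -
  have "\<forall>w. g (u - v) w = 0" using assms by (simp add: bilinear_lsub[OF bilinear])
  then show ?thesis using nondegenerate unfolding nondegenerate_def by force
qed

text \<open>Existence comes from the Riesz-type lemma and uniqueness from nondegeneracy. Together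
  with \<open>g_eqI\<close>, this turns identities between Jacobi operators into identities for
  \<open>A\<close>.\<close>

lemma g_J: "g (J x y) w = A y x x w"
proof -
  obtain u where u: "\<forall>w. g u w = A y x x w"
    using has_signature_riesz[OF bilinear signature A_linear(4)] by blast
  have "J x y = u"
    unfolding jacobi_operator_def curvature_operator_def
  proof (rule the_equality)
    show "v = u" if "\<forall>w. g v w = A y x x w" for v
      using that u by (intro g_eqI) simp
  qed (rule u)
  then show ?thesis using u by simp
qed

lemma linear_J: "linear (J x)"
  by (rule linearI; rule g_eqI)
    (simp_all add: g_J bilinear_ladd[OF bilinear] bilinear_lmul[OF bilinear] A_add A_scale)

lemma A_same: "A x x z w = 0" "A x y z z = 0"
  using A_antisym[of x x z w] A_antisym[of z z x y] A_pair[of x y z z] by auto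

lemma J_self: "J x x = 0"
  by (rule g_eqI) (simp add: g_J A_same bilinear_lzero[OF bilinear])

text \<open>Paired with \<open>w\<close>, the term \<open>J (x + y) x\<close> gives
  \<open>A x y x w + A x y y w\<close>. The second summand cancels against \<open>J y x\<close>, and
  antisymmetry turns the first into \<open>J x y\<close>.\<close>

lemma J_polarized: "J x y = J y x - J (x + y) x"
proof (rule g_eqI)
  fix w
  show "g (J x y) w = g (J y x - J (x + y) x) w"
    using A_antisym[of x y x w] by (simp add: g_J bilinear_lsub[OF bilinear] A_add A_same)
qed

text \<open>Pair symmetry followed by antisymmetry in both pairs exchanges \<open>y\<close> and
  \<open>w\<close> in \<open>A y x x w\<close>.\<close>

lemma J_self_adjoint: "g (J x y) w = g y (J x w)"
proof -
  have "A y x x w = A w x x y"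
    using A_pair[of y x x w] A_antisym[of x w y x] A_pair[of w x y x] A_antisym[of y x w x]
      A_pair[of x y w x] by linarith
  then show ?thesis by (simp add: g_J sym[of y])
qed

text \<open>Polarising \<open>A b a a w = 0\<close> makes \<open>A\<close> skew in its two middle
  arguments. Being skew in the first two as well, it is invariant under cyclic permutations of the
  first three, so the Bianchi sum is three times \<open>A x y z w\<close>.\<close>

lemma A_zero_if_J_zero:
  assumes "\<And>x y. J x y = 0"
  shows "A x y z w = 0"
proof -
  have diag: "A b a a w = 0" for a b w
    using assms g_J[of a b w] by (simp add: bilinear_lzero[OF bilinear])
  have swap: "A a b c w = - A a c b w" for a b c w
    using diag[of a "b + c" w] diag[of a b w] diag[of a c w] by (simp add: A_add)
  show ?thesis
    using A_bianchi[of x y z w] swap[of y z x w] A_antisym[of y x z w] A_antisym[of z x y w]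
      swap[of x z y w] by linarith
qed

text \<open>The Jacobi operator is quadratic in its index, so it vanishes at \<open>x\<close> once
  it vanishes at \<open>s + x\<close>, \<open>s - x\<close> and \<open>s\<close>. A large multiple
  \<open>s\<close> of a timelike vector makes all three timelike.\<close>

lemma J_zero_if_Lorentzian:
  assumes p: "p = 1" and timelike: "\<And>t y. g t t < 0 \<Longrightarrow> J t y = 0"
  shows "J x y = 0"
proof -
  obtain e where e: "g e e = -1"
    using lorentzian_timelike_complement[OF bilinear] signature p by metis
  \<comment> \<open>k is so large that \<open>k *\<^sub>R e \<plusminus> x\<close> are both timelike.\<close>
  define k where "k = 1 + 2 * \<bar>g e x\<bar> + \<bar>g x x\<bar>"
  define s where "s = k *\<^sub>R e"
  have k: "1 \<le> k" unfolding k_def by simp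
  have "\<bar>g x x\<bar> \<le> k * \<bar>g x x\<bar>" using k by (simp add: mult_le_cancel_right1)
  \<comment> \<open>Only one factor is expanded: the summand \<open>k\<close> stays as strict slack,
    and the others dominate the two absolute values in \<open>bound\<close>.\<close>
  moreover have "k * k = k + 2 * (k * \<bar>g e x\<bar>) + k * \<bar>g x x\<bar>"
    by (subst (2) k_def) (simp add: algebra_simps)
  moreover have "\<bar>k * g e x\<bar> = k * \<bar>g e x\<bar>" using k by (simp add: abs_mult)
  ultimately have bound: "- (k * k) + 2 * \<bar>k * g e x\<bar> + \<bar>g x x\<bar> < 0" using k by linarith
  note expand = bilinear_ladd[OF bilinear] bilinear_radd[OF bilinear] bilinear_lsub[OF bilinear]
    bilinear_rsub[OF bilinear] bilinear_lmul[OF bilinear] bilinear_rmul[OF bilinear]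
  have "g (s + x) (s + x) = - (k * k) + 2 * (k * g e x) + g x x"
    "g (s - x) (s - x) = - (k * k) - 2 * (k * g e x) + g x x" "g s s = - (k * k)"
    unfolding s_def using e sym[of x e] by (simp_all add: expand algebra_simps)
  then have "g (s + x) (s + x) < 0" "g (s - x) (s - x) < 0" "g s s < 0"
    using bound by (auto simp: abs_if split: if_splits)
  then have zero: "J (s + x) y = 0" "J (s - x) y = 0" "J s y = 0" by (auto intro: timelike)
  show ?thesis
  proof (rule g_eqI)
    fix w
    have "A y (s + x) (s + x) w = 0" "A y (s - x) (s - x) w = 0" "A y s s w = 0"
      using zero g_J[of "s + x" y w] g_J[of "s - x" y w] g_J[of s y w]
      by (simp_all add: bilinear_lzero[OF bilinear])
    \<comment> \<open>Adding the first two equations cancels the mixed terms and leaves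
      \<open>2 * A y s s w + 2 * A y x x w = 0\<close>.\<close>
    then have "A y x x w = 0" by (simp add: A_add A_diff)
    then show "g (J x y) w = g 0 w" by (simp add: g_J bilinear_lzero[OF bilinear])
  qed
qed

end

section \<open>Commuting Jacobi operators\<close>

locale jacobi_tsankov_model = curvature_model +
  assumes jacobi_tsankov: "jacobi_tsankov g A"
begin

lemma J_commute: "J x (J y z) = J y (J x z)"
  using jacobi_tsankov unfolding jacobi_tsankov_def by (metis comp_apply)

lemma J_square: "J x (J x y) = 0"
proof -
  have "J x (J x y) = J x (J y x) - J x (J (x + y) x)"
    by (subst (2) J_polarized) (rule linear_diff[OF linear_J])
  also have "\<dots> = J y (J x x) - J (x + y) (J x x)" by (simp only: J_commute[of x])
  also have "\<dots> = 0" by (simp add: J_self linear_0[OF linear_J])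
  finally show ?thesis .
qed

text \<open>Since \<open>J x\<close> kills \<open>x\<close> itself, a nonzero \<open>x\<close> is an
  eigenvector for 0. The set does not depend on \<open>x\<close>, which is the Osserman
  property.\<close>

lemma J_eigenvalues: "x \<noteq> 0 \<Longrightarrow> complex_eigenvalues (J x) = {0}"
  by (rule complex_eigenvalues_square_zero[where x = x]) (simp_all add: linear_J J_square J_self)

lemma osserman: "osserman g A"
proof -
  have "x \<noteq> 0" if "g x x = 1 \<or> g x x = -1" for x
    using that bilinear_lzero[OF bilinear] by force
  then show ?thesis unfolding osserman_def by (auto simp: J_eigenvalues)
qed

lemma J_null: "g (J x y) (J x y) = 0"
  by (subst J_self_adjoint) (simp add: J_square bilinear_rzero[OF bilinear])

lemma A_zero:
  assumes "p = 0 \<or> p = 1"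
  shows "A x y z w = 0"
proof (rule A_zero_if_J_zero)
  fix x y
  show "J x y = 0"
  proof (cases "p = 0")
    case True
    then have "has_signature g 0 q" using signature by simp
    then show ?thesis by (rule riemannian_null_vector[OF bilinear]) (rule J_null)
  next
    case False
    with assms have p: "p = 1" by simp
    then have sig: "has_signature g 1 q" using signature by simp
    show ?thesis
    proof (rule J_zero_if_Lorentzian[OF p])
      fix t y assume "g t t < 0"
      \<comment> \<open>The pairing equals \<open>A y t t t\<close>, which vanishes by antisymmetry
        in the last two arguments.\<close>
      moreover have "g t (J t y) = 0" by (simp add: sym[of t] g_J A_same)
      ultimately show "J t y = 0"
        by (rule lorentzian_null_orthogonal_to_timelike[OF bilinear sym sig]) (rule J_null)
    qed
  qed
qed

end

theorem theorem1p4: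
  fixes g :: "'v::real_vector \<Rightarrow> 'v \<Rightarrow> real"
    and A :: "'v \<Rightarrow> 'v \<Rightarrow> 'v \<Rightarrow> 'v \<Rightarrow> real"
    and p q :: nat
  assumes "finite_dim TYPE('v)"
    and "bilinear g"
    and "\<And>x y. g x y = g y x"
    and "nondegenerate g"
    and "has_signature g p q"
    and "algebraic_curvature_tensor A"
    and "jacobi_tsankov g A"
  shows "(\<forall>x. jacobi_operator g A x \<circ> jacobi_operator g A x = (\<lambda>y. 0)) \<and>
         osserman g A \<and>
         (p = 0 \<or> p = 1 \<longrightarrow> A = (\<lambda>x y z w. 0))"
proof -
  interpret jacobi_tsankov_model g A p q
    using assms by unfold_locales
  show ?thesis using J_square osserman A_zero by (auto simp: fun_eq_iff)
qed

end
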